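(* Let $\mathbf{c}=(c_0,c_1,\dots,c_n)\in\mathfrak{C}_+(N)$ and $P\in\mathfrak{P}_+(N)$. Then the problem to maximize $$\mathbb{I}_P(\Phi)=\frac{1}{2N}\sum_{j=-N+1}^{N}P(\zeta_j)\log\Phi(\zeta_j)$$ over all positive functions $\Phi$ on $\{\zeta_j: j=-N+1,\dots,N\}$ subject to the moment conditions $$\frac{1}{2N}\sum_{j=-N+1}^{N}\zeta_j^{k}\,\Phi(\zeta_j)=c_k,\qquad k=0,1,\dots,n,$$ has a unique solution, namely $\Phi=P/Q$, where $Q$ is the unique optimal solution of the problem to minimize $$\mathbb{J}_P(Q)=\langle C,Q\rangle-\frac{1}{2N}\sum_{j=-N+1}^{N}P(\zeta_j)\log Q(\zeta_j)$$ over all $Q\in\mathfrak{P}_+(N)$.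
   Context: Let $n<N$ be positive integers and $\zeta_j=e^{i\pi j/N}$, $j=-N+1,\dots,N$ (the $2N$-th roots of unity). Let $\mathfrak{P}$ be the finite-dimensional real vector space of symmetric trigonometric polynomials $P(\zeta)=\sum_{k=-n}^{n}p_k\zeta^{-k}$, with $p_k\in\mathbb{C}$, $p_{-k}=\overline{p_k}$ (so $P$ is real-valued on the unit circle). Put $$\mathfrak{P}_+(N)=\{P\in\mathfrak{P}: P(\zeta_j)>0,\ j=-N+1,\dots,N\},$$ and let $\overline{\mathfrak{P}_+(N)}$ be its closure in $\mathfrak{P}$. For $\mathbf{c}=(c_0,c_1,\dots,c_n)$ with $c_0$ real and $c_1,\dots,c_n$ complex, put $c_{-k}=\overline{c_k}$, $C(\zeta)=\sum_{k=-n}^n c_k\zeta^{-k}$ and, for $P\in\mathfrak{P}$, $\langle C,P\rangle=\sum_{k=-n}^{n}c_k\overline{p_k}$ (similarly $\langle C,Q\rangle=\sum_{k=-n}^n c_k\overline{q_k}$). The (open) dual cone is $$\mathfrak{C}_+(N)=\{\mathbf{c}: \langle C,P\rangle>0\ \text{for all } P\in\overline{\mathfrak{P}_+(N)}\setminus\{0\}\}.$$ *)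

theory Defs
  imports "HOL-Analysis.Analysis"
begin

definition zeta :: "nat \<Rightarrow> int \<Rightarrow> complex" where
  "zeta N j = exp (\<i> * of_real (pi * of_int j / of_nat N))"

definition idx :: "nat \<Rightarrow> int set" where
  "idx N = {- int N + 1..int N}"

definition grid :: "nat \<Rightarrow> complex set" where
  "grid N = zeta N ` idx N"

(* A symmetric trigonometric polynomial is represented by its coefficient family (p_k),
   indexed by the integers and zero outside {-n..n}. *)
definition sym_trig :: "nat \<Rightarrow> (int \<Rightarrow> complex) set" where
  "sym_trig n = {p. (\<forall>k. p (- k) = cnj (p k)) \<and> (\<forall>k. k \<notin> {- int n..int n} \<longrightarrow> p k = 0)}"

definition trig_poly :: "nat \<Rightarrow> (int \<Rightarrow> complex) \<Rightarrow> complex \<Rightarrow> complex" where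
  "trig_poly n p z = (\<Sum>k = - int n..int n. p k * z powi (- k))"

definition pos_trig :: "nat \<Rightarrow> nat \<Rightarrow> (int \<Rightarrow> complex) set" where
  "pos_trig n N = {p \<in> sym_trig n. \<forall>j\<in>idx N. 0 < Re (trig_poly n p (zeta N j))}"

(* The topology is the one induced on the subspace by the product topology on coefficient
   families; on this finite-dimensional space it is the usual one. *)
definition closed_pos_trig :: "nat \<Rightarrow> nat \<Rightarrow> (int \<Rightarrow> complex) set" where
  "closed_pos_trig n N = top_of_set (sym_trig n) closure_of pos_trig n N"

definition herm_ext :: "(nat \<Rightarrow> complex) \<Rightarrow> int \<Rightarrow> complex" where
  "herm_ext c k = (if 0 \<le> k then c (nat k) else cnj (c (nat (- k))))"

definition pairing :: "nat \<Rightarrow> (int \<Rightarrow> complex) \<Rightarrow> (int \<Rightarrow> complex) \<Rightarrow> complex" where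
  "pairing n c p = (\<Sum>k = - int n..int n. c k * cnj (p k))"

(* Tuples (c_0, ..., c_n) are functions on nat; values beyond n are never used. *)
definition dual_cone :: "nat \<Rightarrow> nat \<Rightarrow> (nat \<Rightarrow> complex) set" where
  "dual_cone n N = {c. c 0 \<in> \<real> \<and>
     (\<forall>p \<in> closed_pos_trig n N - {\<lambda>_. 0}. 0 < Re (pairing n (herm_ext c) p))}"

(* Taking real parts loses nothing: the values concerned are real. *)
lemma trig_poly_real:
  assumes "p \<in> sym_trig n" and "norm z = 1"
  shows "trig_poly n p z \<in> \<real>"
proof -
  have p: "p (- k) = cnj (p k)" for k
    using assms(1) by (simp add: sym_trig_def)
  have z: "cnj z = inverse z"
    using assms(2) by (metis complex_div_cnj div_by_1 inverse_eq_divide mult_1 of_real_1 power_one)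
  have "cnj (trig_poly n p z) = (\<Sum>k = - int n..int n. p (- k) * z powi k)"
    by (simp add: trig_poly_def p z power_int_minus power_int_inverse)
  also have "\<dots> = trig_poly n p z"
    unfolding trig_poly_def by (rule sum.reindex_bij_witness[of _ uminus uminus]) auto
  finally show ?thesis
    by (simp add: Reals_cnj_iff)
qed

lemma norm_zeta: "norm (zeta N j) = 1"
  unfolding zeta_def by (simp only: norm_exp_i_times)

lemma pairing_real:
  assumes "c 0 \<in> \<real>" and "p \<in> sym_trig n"
  shows "pairing n (herm_ext c) p \<in> \<real>"
proof -
  have p: "p (- k) = cnj (p k)" for k
    using assms(2) by (simp add: sym_trig_def)
  have c: "herm_ext c (- k) = cnj (herm_ext c k)" for k
    using assms(1) by (auto simp: herm_ext_def Reals_cnj_iff)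
  have "cnj (pairing n (herm_ext c) p) =
      (\<Sum>k = - int n..int n. herm_ext c (- k) * cnj (p (- k)))"
    by (simp add: pairing_def p c)
  also have "\<dots> = pairing n (herm_ext c) p"
    unfolding pairing_def by (rule sum.reindex_bij_witness[of _ uminus uminus]) auto
  finally show ?thesis
    by (simp add: Reals_cnj_iff)
qed

definition primal :: "nat \<Rightarrow> nat \<Rightarrow> (int \<Rightarrow> complex) \<Rightarrow> (complex \<Rightarrow> real) \<Rightarrow> real" where
  "primal n N p \<Phi> =
     1 / (2 * real N) * (\<Sum>j\<in>idx N. Re (trig_poly n p (zeta N j)) * ln (\<Phi> (zeta N j)))"

(* Functions on the grid are extensional (undefined off the grid), so that equality of
   functions is equality on the grid. *)
definition feasible :: "nat \<Rightarrow> nat \<Rightarrow> (nat \<Rightarrow> complex) \<Rightarrow> (complex \<Rightarrow> real) set" where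
  "feasible n N c = {\<Phi> \<in> grid N \<rightarrow>\<^sub>E {0<..}.
     \<forall>k\<le>n. 1 / (2 * of_nat N) * (\<Sum>j\<in>idx N. zeta N j ^ k * of_real (\<Phi> (zeta N j))) = c k}"

definition dual ::
  "nat \<Rightarrow> nat \<Rightarrow> (nat \<Rightarrow> complex) \<Rightarrow> (int \<Rightarrow> complex) \<Rightarrow> (int \<Rightarrow> complex) \<Rightarrow> real" where
  "dual n N c p q = Re (pairing n (herm_ext c) q)
     - 1 / (2 * real N) *
       (\<Sum>j\<in>idx N. Re (trig_poly n p (zeta N j)) * ln (Re (trig_poly n q (zeta N j))))"

definition trig_quot ::
  "nat \<Rightarrow> nat \<Rightarrow> (int \<Rightarrow> complex) \<Rightarrow> (int \<Rightarrow> complex) \<Rightarrow> complex \<Rightarrow> real" where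
  "trig_quot n N p q = (\<lambda>z\<in>grid N. Re (trig_poly n p z) / Re (trig_poly n q z))"

end

theory Submission
  imports Defs
begin

text \<open>
  The dual problem is solved first, by compactness, and its solution then produces the solution of
  the primal problem.

  Because \<open>n < N\<close>, discrete Fourier inversion recovers a symmetric trigonometric polynomial of degree
  at most \<open>n\<close> from its values at the \<open>2N\<close>-th roots of unity (\<open>coeff_eq_grid_sum\<close>). Hence a bound on
  the grid values bounds the coefficients, and boxes in terms of grid values are compact
  (\<open>compact_grid_box\<close>). Compactness makes strict positivity of \<open>\<langle>C, q\<rangle>\<close> on the closed cone
  quantitative: \<open>\<langle>C, q\<rangle> \<ge> \<delta> \<cdot> (\<Sum>\<^sub>j q(\<zeta>\<^sub>j))\<close> for some \<open>\<delta> > 0\<close> (\<open>dual_cone_coercive\<close>). The dual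
  functional is therefore bounded below by a sum of terms \<open>\<delta> x - b ln x\<close> with \<open>b > 0\<close>, one for each
  grid value \<open>x\<close>. Such terms blow up both as \<open>x\<close> tends to \<open>0\<close> and as it tends to infinity, so
  sublevel sets lie in a compact box inside the open cone and a minimiser \<open>Q\<close> exists
  (\<open>dual_minimiser_exists\<close>).

  The cone is open, so the derivative of the dual functional vanishes at \<open>Q\<close> in every direction, and
  this says exactly that \<open>P/Q\<close> satisfies the moment conditions (\<open>stationary_quot_feasible\<close>).

  For a feasible \<open>\<Phi>\<close> the moment conditions fix the weighted sum \<open>\<Sum>\<^sub>j \<Phi>(\<zeta>\<^sub>j) Q(\<zeta>\<^sub>j)\<close>, and the
  inequality \<open>ln x \<le> x - 1\<close> at \<open>x = \<Phi> Q / P\<close> shows that \<open>P/Q\<close> is optimal. Equality forces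
  \<open>x = 1\<close>, which is uniqueness (\<open>primal_le_trig_quot\<close>). Uniqueness of \<open>Q\<close> follows in turn: two
  minimisers yield the same quotient on the grid, hence the same grid values, hence the same
  coefficients.
\<close>

section \<open>Values on the grid\<close>

definition grid_val :: "nat \<Rightarrow> nat \<Rightarrow> (int \<Rightarrow> complex) \<Rightarrow> int \<Rightarrow> real" where
  "grid_val n N q j = Re (trig_poly n q (zeta N j))"

abbreviation line_comb :: "(int \<Rightarrow> complex) \<Rightarrow> real \<Rightarrow> (int \<Rightarrow> complex) \<Rightarrow> int \<Rightarrow> complex" where
  "line_comb q t h \<equiv> (\<lambda>k. q k + of_real t * h k)"

lemma finite_idx [simp]: "finite (idx N)"
  by (simp add: idx_def)

lemma trig_poly_eq_grid_val:
  "q \<in> sym_trig n \<Longrightarrow> trig_poly n q (zeta N j) = of_real (grid_val n N q j)"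
  unfolding grid_val_def using trig_poly_real[of q n "zeta N j"] norm_zeta[of N j] by simp

lemma pos_trig_iff: "q \<in> pos_trig n N \<longleftrightarrow> q \<in> sym_trig n \<and> (\<forall>j\<in>idx N. 0 < grid_val n N q j)"
  by (simp add: pos_trig_def grid_val_def)

lemma sym_trig_line_comb:
  "q \<in> sym_trig n \<Longrightarrow> h \<in> sym_trig n \<Longrightarrow> line_comb q t h \<in> sym_trig n"
  by (simp add: sym_trig_def)

lemma sym_trig_scale: "q \<in> sym_trig n \<Longrightarrow> (\<lambda>k. of_real t * q k) \<in> sym_trig n"
  by (simp add: sym_trig_def)

lemma grid_val_line_comb:
  "grid_val n N (line_comb q t h) j = grid_val n N q j + t * grid_val n N h j"
proof -
  have "trig_poly n (line_comb q t h) z = trig_poly n q z + of_real t * trig_poly n h z" for z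
    by (simp add: trig_poly_def algebra_simps sum.distrib sum_distrib_left)
  then show ?thesis
    by (simp add: grid_val_def)
qed

lemma grid_val_scale: "grid_val n N (\<lambda>k. of_real t * q k) j = t * grid_val n N q j"
  using grid_val_line_comb[of n N "\<lambda>_. 0" t q j] by (simp add: grid_val_def trig_poly_def)

lemma pairing_line_comb:
  "Re (pairing n c (line_comb q t h)) = Re (pairing n c q) + t * Re (pairing n c h)"
proof -
  have "pairing n c (line_comb q t h) = pairing n c q + of_real t * pairing n c h"
    by (simp add: pairing_def algebra_simps sum.distrib sum_distrib_left)
  then show ?thesis
    by simp
qed

lemma pairing_scale: "Re (pairing n c (\<lambda>k. of_real t * q k)) = t * Re (pairing n c q)"
  using pairing_line_comb[of n c "\<lambda>_. 0" t q] by (simp add: pairing_def)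

lemma continuous_on_grid_val: "continuous_on A (\<lambda>q. grid_val n N q j)"
  unfolding grid_val_def trig_poly_def
  by (intro continuous_intros continuous_on_subset[OF continuous_on_product_coordinates]) auto

lemma continuous_on_pairing: "continuous_on A (\<lambda>q. Re (pairing n c q))"
  unfolding pairing_def
  by (intro continuous_intros continuous_on_subset[OF continuous_on_product_coordinates]) auto

section \<open>Coefficients are determined by grid values\<close>

lemma zeta_power_int: "zeta N j powi k = exp (\<i> * of_real (pi * of_int j * of_int k / of_nat N))"
proof -
  have "zeta N j powi k = exp (of_int k * (\<i> * of_real (pi * of_int j / of_nat N)))"
    unfolding zeta_def by (simp only: exp_power_int)
  then show ?thesis
    by (simp add: mult_ac)
qed

lemma zeta_nonzero [simp]: "zeta N j \<noteq> 0"
  by (simp add: zeta_def)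

lemma cnj_zeta: "cnj (zeta N j) = inverse (zeta N j)"
  by (metis norm_zeta complex_div_cnj div_by_1 inverse_eq_divide mult_1 of_real_1 power_one)

text \<open>Orthogonality of the characters of the group of \<open>2N\<close>-th roots of unity: multiplying the sum by
  \<open>\<zeta>\<^sub>1\<^sup>l \<noteq> 1\<close> shifts the index by one, and by periodicity this permutes the terms,
  so the sum equals a multiple of itself and vanishes.\<close>

lemma sum_zeta_power_int:
  assumes "0 < N" and "\<bar>l\<bar> < 2 * int N"
  shows "(\<Sum>j\<in>idx N. zeta N j powi l) = (if l = 0 then 2 * of_nat N else 0)"
proof (cases "l = 0")
  case True
  then show ?thesis
    by (simp add: idx_def)
next
  case False
  define f where "f j = zeta N j powi l" for j
  define S where "S = (\<Sum>j\<in>idx N. f j)"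
  have mult: "f (j + 1) = f 1 * f j" for j
    by (simp add: f_def zeta_power_int flip: exp_add)
      (simp add: algebra_simps add_divide_distrib)
  have per: "f (int N + 1) = f (- int N + 1)"
  proof -
    have "f (int N + 1) = exp (\<i> * of_real (pi * (- of_nat N + 1) * of_int l / of_nat N)
        + of_int (2 * l) * (of_real pi * \<i>))"
      using assms(1) by (simp add: f_def zeta_power_int field_simps)
    also have "\<dots> = f (- int N + 1)"
      unfolding f_def zeta_power_int exp_add
      using exp_integer_2pi[of "of_int l"] by (simp add: algebra_simps)
    finally show ?thesis .
  qed
  have ne: "f 1 \<noteq> 1"
  proof
    assume "f 1 = 1"
    then obtain m :: int where "pi * of_int l / of_nat N = of_int (2 * m) * pi"
      unfolding f_def zeta_power_int exp_eq_1 by auto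
    then have "real_of_int l = of_int (2 * m * int N)"
      using assms(1) by (simp add: field_simps)
    then have "l = 2 * int N * m"
      by (simp only: of_int_eq_iff mult_ac)
    moreover from this have "m \<noteq> 0"
      using False by auto
    then have "1 \<le> \<bar>m\<bar>"
      by linarith
    then have "2 * int N * 1 \<le> 2 * int N * \<bar>m\<bar>"
      by (intro mult_left_mono) auto
    ultimately show False
      using assms(2) by (simp add: abs_mult)
  qed
  have "f 1 * S = (\<Sum>j\<in>idx N. f (j + 1))"
    by (simp add: S_def mult sum_distrib_left)
  also have "\<dots> = (\<Sum>j\<in>{- int N + 2..int N + 1}. f j)"
    by (rule sum.reindex_bij_witness[of _ "\<lambda>j. j - 1" "\<lambda>j. j + 1"]) (auto simp: idx_def)
  also have "{- int N + 2..int N + 1} = insert (int N + 1) {- int N + 2..int N}"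
    using assms(1) by auto
  also have "(\<Sum>j\<in>\<dots>. f j) = f (- int N + 1) + (\<Sum>j\<in>{- int N + 2..int N}. f j)"
    by (simp add: per)
  also have "\<dots> = (\<Sum>j\<in>insert (- int N + 1) {- int N + 2..int N}. f j)"
    by simp
  also have "insert (- int N + 1) {- int N + 2..int N} = idx N"
    using assms(1) by (auto simp: idx_def)
  finally have "f 1 * S = S"
    by (simp add: S_def)
  then have "S = 0"
    using ne by simp
  then show ?thesis
    using False by (simp add: S_def f_def)
qed

text \<open>For \<open>n < N\<close> no two frequencies in \<open>{-n..n}\<close> are congruent modulo \<open>2N\<close>, so sampling on the grid
  causes no aliasing.\<close>

lemma coeff_eq_grid_sum:
  assumes "n < N" and "q \<in> sym_trig n" and "k \<in> {- int n..int n}"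
  shows "q k = 1 / (2 * of_nat N) * (\<Sum>j\<in>idx N. of_real (grid_val n N q j) * zeta N j powi k)"
proof -
  have "(\<Sum>j\<in>idx N. of_real (grid_val n N q j) * zeta N j powi k)
      = (\<Sum>j\<in>idx N. \<Sum>m = - int n..int n. q m * zeta N j powi (k - m))"
    using assms(2)
    by (simp add: trig_poly_eq_grid_val[symmetric] trig_poly_def sum_distrib_right mult.assoc
        flip: power_int_add)
  also have "\<dots> = (\<Sum>m = - int n..int n. q m * (\<Sum>j\<in>idx N. zeta N j powi (k - m)))"
    by (subst sum.swap) (simp add: sum_distrib_left)
  also have "\<dots> = (\<Sum>m = - int n..int n. if m = k then q k * (2 * of_nat N) else 0)"
  proof (rule sum.cong[OF refl])
    fix m assume "m \<in> {- int n..int n}"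
    then have "\<bar>k - m\<bar> < 2 * int N"
      using assms(1,3) by auto
    then show "q m * (\<Sum>j\<in>idx N. zeta N j powi (k - m))
        = (if m = k then q k * (2 * of_nat N) else 0)"
      using assms(1) by (simp add: sum_zeta_power_int)
  qed
  also have "\<dots> = q k * (2 * of_nat N)"
    using assms(3) by simp
  finally show ?thesis
    using assms(1) by simp
qed

lemma sym_trig_eqI:
  assumes "n < N" and "p \<in> sym_trig n" "q \<in> sym_trig n"
    and "\<And>j. j \<in> idx N \<Longrightarrow> grid_val n N p j = grid_val n N q j"
  shows "p = q"
proof
  fix k
  show "p k = q k"
  proof (cases "k \<in> {- int n..int n}")
    case True
    then show ?thesis
      using assms by (simp add: coeff_eq_grid_sum[OF assms(1)] cong: sum.cong)
  next
    case False
    then show ?thesis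
      using assms(2,3) by (simp add: sym_trig_def)
  qed
qed

section \<open>Compactness and coercivity\<close>

lemma closed_sym_trig: "closed (sym_trig n)"
  unfolding sym_trig_def
  by (intro closed_Collect_conj closed_Collect_all closed_Collect_imp closed_Collect_eq
      open_Collect_const continuous_intros continuous_on_product_coordinates)

text \<open>Tychonoff's theorem for the product of the discs of radius \<open>R\<close>.\<close>

lemma compact_bounded_coeffs: "compact {q :: int \<Rightarrow> complex. \<forall>k. norm (q k) \<le> R}"
proof -
  have "compactin (product_topology (\<lambda>_. euclidean) UNIV) (PiE UNIV (\<lambda>_ :: int. cball (0 :: complex) R))"
    by (simp add: compactin_PiE)
  then show ?thesis
    by (simp add: euclidean_product_topology PiE_UNIV_domain Pi_def)
qed

text \<open>By Fourier inversion each coefficient is bounded by the average modulus of the grid values, so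
  the box is a closed subset of a product of discs.\<close>

lemma compact_grid_box:
  assumes "n < N"
  shows "compact {q \<in> sym_trig n. \<forall>j\<in>idx N. l j \<le> grid_val n N q j \<and> grid_val n N q j \<le> u j}"
    (is "compact ?K")
proof -
  define R where "R = 1 / (2 * real N) * (\<Sum>j\<in>idx N. \<bar>l j\<bar> + \<bar>u j\<bar>)"
  have "?K = {q. \<forall>k. norm (q k) \<le> R} \<inter> ?K"
  proof -
    have "norm (q k) \<le> R" if q: "q \<in> ?K" for q k
    proof (cases "k \<in> {- int n..int n}")
      case True
      have "norm (\<Sum>j\<in>idx N. of_real (grid_val n N q j) * zeta N j powi k)
          \<le> (\<Sum>j\<in>idx N. \<bar>l j\<bar> + \<bar>u j\<bar>)"
        using q by (intro sum_norm_le)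
          (force simp: norm_mult norm_power_int norm_zeta)
      then show ?thesis
        using q True assms
        by (simp add: coeff_eq_grid_sum[OF assms, of q k] R_def norm_mult norm_divide divide_right_mono)
    next
      case False
      then show ?thesis
        using q by (auto simp: sym_trig_def R_def intro!: divide_nonneg_nonneg sum_nonneg)
    qed
    then show ?thesis
      by blast
  qed
  moreover have "closed ?K"
  proof -
    have "closed {q. q \<in> sym_trig n}"
      using closed_sym_trig by simp
    moreover have "closed {q. \<forall>j. j \<in> idx N \<longrightarrow> l j \<le> grid_val n N q j \<and> grid_val n N q j \<le> u j}"
      by (intro closed_Collect_conj closed_Collect_all closed_Collect_imp closed_Collect_le
          open_Collect_const continuous_intros continuous_on_grid_val)
    ultimately show ?thesis
      unfolding Ball_def by (rule closed_Collect_conj)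
  qed
  ultimately show ?thesis
    by (metis (no_types, lifting) compact_Int_closed compact_bounded_coeffs)
qed

text \<open>Adding a small positive multiple of any member \<open>P\<close> of the open cone makes all grid values
  positive.\<close>

lemma nonneg_in_closed_pos_trig:
  assumes "P \<in> pos_trig n N" and "q \<in> sym_trig n" and "\<And>j. j \<in> idx N \<Longrightarrow> 0 \<le> grid_val n N q j"
  shows "q \<in> closed_pos_trig n N"
  unfolding closed_pos_trig_def in_closure_of
proof (intro conjI allI impI)
  show "q \<in> topspace (top_of_set (sym_trig n))"
    using assms(2) by simp
  fix T
  assume "q \<in> T \<and> openin (top_of_set (sym_trig n)) T"
  then obtain U where U: "open U" "T = sym_trig n \<inter> U" "q \<in> U"
    by (auto simp: openin_open)
  have "continuous_on UNIV (\<lambda>t. line_comb q t P)"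
    by (intro continuous_on_coordinatewise_then_product continuous_intros)
  then have "open ((\<lambda>t. line_comb q t P) -` U)"
    using U(1) by (simp add: continuous_on_open_vimage)
  moreover have "0 \<in> (\<lambda>t. line_comb q t P) -` U"
    using U(3) by simp
  ultimately obtain e where "e > 0" and e: "ball 0 e \<subseteq> (\<lambda>t. line_comb q t P) -` U"
    by (meson open_contains_ball)
  define t where "t = e / 2"
  have "0 < t" "t < e"
    using \<open>e > 0\<close> by (simp_all add: t_def)
  then have "line_comb q t P \<in> U"
    using subsetD[OF e, of t] by simp
  moreover have "line_comb q t P \<in> pos_trig n N"
    using assms \<open>0 < t\<close>
    by (auto simp: pos_trig_iff sym_trig_line_comb grid_val_line_comb intro!: add_nonneg_pos)
  ultimately show "\<exists>y. y \<in> pos_trig n N \<and> y \<in> T"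
    using U(2) by (auto simp: pos_trig_iff)
qed

text \<open>The bound is homogeneous in \<open>q\<close>, so it suffices to treat the slice of the closed cone where the
  grid values sum to one. That slice is compact and avoids \<open>0\<close>, so the pairing attains a positive
  minimum on it, which serves as \<open>\<delta>\<close>.\<close>

lemma dual_cone_coercive:
  assumes "n < N" and "c \<in> dual_cone n N" and "P \<in> pos_trig n N"
  obtains \<delta> where "0 < \<delta>"
    and "\<And>q. q \<in> pos_trig n N \<Longrightarrow>
      \<delta> * (\<Sum>j\<in>idx N. grid_val n N q j) \<le> Re (pairing n (herm_ext c) q)"
proof -
  define K where "K = {q \<in> sym_trig n. \<forall>j\<in>idx N. 0 \<le> grid_val n N q j \<and> grid_val n N q j \<le> 1}
    \<inter> {q. (\<Sum>j\<in>idx N. grid_val n N q j) = 1}"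
  have idx: "idx N \<noteq> {}"
    using assms(1) by (auto simp: idx_def)
  have "compact K"
    unfolding K_def
    by (intro compact_Int_closed compact_grid_box assms closed_Collect_eq continuous_intros
        continuous_on_grid_val)
  have norm_in_K: "(\<lambda>k. of_real (1 / s) * q k) \<in> K" and s_pos: "0 < s"
    if q: "q \<in> pos_trig n N" and s: "s = (\<Sum>j\<in>idx N. grid_val n N q j)" for q s
  proof -
    show "0 < s"
      using q idx by (auto simp: s pos_trig_iff intro!: sum_pos)
    moreover have "grid_val n N q j \<le> s" if "j \<in> idx N" for j
      unfolding s using q that by (intro member_le_sum) (auto simp: pos_trig_iff less_imp_le)
    ultimately show "(\<lambda>k. of_real (1 / s) * q k) \<in> K"
      using q sym_trig_scale[of q n "1 / s"]
      by (auto simp: K_def pos_trig_iff grid_val_scale[of n N "1 / s", simplified]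
          divide_le_eq s[symmetric] sum_divide_distrib[symmetric] less_imp_le)
  qed
  have "K \<noteq> {}"
    using norm_in_K[OF assms(3) refl] by blast
  then obtain q0 where q0: "q0 \<in> K"
    and min: "\<And>q. q \<in> K \<Longrightarrow> Re (pairing n (herm_ext c) q0) \<le> Re (pairing n (herm_ext c) q)"
    using continuous_attains_inf[OF \<open>compact K\<close> _ continuous_on_pairing] by blast
  show thesis
  proof
    have "q0 \<noteq> (\<lambda>_. 0)"
      using q0 by (auto simp: K_def grid_val_def trig_poly_def)
    then show "0 < Re (pairing n (herm_ext c) q0)"
      using assms(2,3) q0 nonneg_in_closed_pos_trig[of P n N q0]
      by (auto simp: dual_cone_def K_def)
    fix q
    assume q: "q \<in> pos_trig n N"
    define s where "s = (\<Sum>j\<in>idx N. grid_val n N q j)"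
    have "Re (pairing n (herm_ext c) q0) \<le> 1 / s * Re (pairing n (herm_ext c) q)"
      using min[OF norm_in_K[OF q s_def]] pairing_scale[of n "herm_ext c" "1 / s" q] by simp
    then show "Re (pairing n (herm_ext c) q0) * (\<Sum>j\<in>idx N. grid_val n N q j)
        \<le> Re (pairing n (herm_ext c) q)"
      using s_pos[OF q s_def] by (simp add: s_def[symmetric] field_simps)
  qed
qed

section \<open>Existence of a dual minimiser\<close>

text \<open>Half of the linear term is spent on absorbing the logarithm, through \<open>ln y \<le> y - 1\<close> at
  \<open>y = a x / (2 b)\<close>. The other half remains, so that a bound on \<open>a x - b ln x\<close> also bounds \<open>x\<close> from
  above.\<close>

lemma linear_minus_ln_lower_bound:
  fixes a b x :: real
  assumes "0 < a" "0 < b" "0 < x"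
  shows "a / 2 * x + b * (1 + ln (a / (2 * b))) \<le> a * x - b * ln x"
proof -
  have "ln (a / (2 * b) * x) \<le> a / (2 * b) * x - 1"
    using assms by (intro ln_le_minus_one) simp
  moreover have "ln (a / (2 * b) * x) = ln (a / (2 * b)) + ln x"
    by (rule ln_mult_pos) (use assms in auto)
  ultimately have "b * (ln (a / (2 * b)) + ln x) \<le> b * (a / (2 * b) * x - 1)"
    using assms by (intro mult_left_mono) auto
  then show ?thesis
    using assms by (simp add: algebra_simps)
qed

lemma linear_minus_ln_sublevel:
  fixes a b x M :: real
  assumes "0 < a" "0 < b" "0 < x" and "a * x - b * ln x \<le> M"
  shows "exp (- M / b) \<le> x" and "x \<le> 2 / a * (M - b * (1 + ln (a / (2 * b))))"
proof -
  have "0 < a * x"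
    using assms by simp
  then have "- M \<le> b * ln x"
    using assms(4) by linarith
  then have "- M / b \<le> ln x"
    using assms(2) by (simp add: field_simps)
  then show "exp (- M / b) \<le> x"
    using assms(3) by (simp add: ln_ge_iff)
  have "a / 2 * x \<le> M - b * (1 + ln (a / (2 * b)))"
    using linear_minus_ln_lower_bound[OF assms(1-3)] assms(4) by simp
  then show "x \<le> 2 / a * (M - b * (1 + ln (a / (2 * b))))"
    using assms(1) by (simp add: field_simps)
qed

lemma dual_eq:
  "dual n N c P q = Re (pairing n (herm_ext c) q)
     - (\<Sum>j\<in>idx N. grid_val n N P j / (2 * real N) * ln (grid_val n N q j))"
  by (simp add: dual_def grid_val_def sum_distrib_left sum_divide_distrib)

text \<open>Coercivity bounds the dual functional below by \<open>\<Sum>\<^sub>j t\<^sub>j\<close> with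
  \<open>t\<^sub>j = \<delta> q(\<zeta>\<^sub>j) - b\<^sub>j ln q(\<zeta>\<^sub>j)\<close>. Each \<open>t\<^sub>j\<close> has a lower bound independent of \<open>q\<close>, so a bound on the
  sum bounds every single \<open>t\<^sub>j\<close> from above and confines \<open>q(\<zeta>\<^sub>j)\<close> to a compact interval in
  \<open>(0, \<infinity>)\<close>. The sublevel set used is the one through \<open>P\<close>, which ensures that it is nonempty.\<close>

lemma dual_minimiser_exists:
  assumes "n < N" and "c \<in> dual_cone n N" and P: "P \<in> pos_trig n N"
  obtains Q where "Q \<in> pos_trig n N" and "\<And>q. q \<in> pos_trig n N \<Longrightarrow> dual n N c P Q \<le> dual n N c P q"
proof -
  obtain \<delta> where "0 < \<delta>" and \<delta>: "\<And>q. q \<in> pos_trig n N \<Longrightarrow>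
      \<delta> * (\<Sum>j\<in>idx N. grid_val n N q j) \<le> Re (pairing n (herm_ext c) q)"
    using dual_cone_coercive[OF assms] by blast
  define b where "b j = grid_val n N P j / (2 * real N)" for j
  \<comment> \<open>\<open>m j\<close> is the uniform lower bound for the \<open>j\<close>-th term; \<open>l\<close> and \<open>u\<close> are the endpoints that the
    one-variable estimates give for the level \<open>M\<close>.\<close>
  define m where "m j = b j * (1 + ln (\<delta> / (2 * b j)))" for j
  define M where "M = dual n N c P P + (\<Sum>j\<in>idx N. \<bar>m j\<bar>)"
  define l where "l j = exp (- M / b j)" for j
  define u where "u j = 2 / \<delta> * (M - m j)" for j
  define K where "K = {q \<in> sym_trig n. \<forall>j\<in>idx N. l j \<le> grid_val n N q j \<and> grid_val n N q j \<le> u j}"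
  have b: "0 < b j" if "j \<in> idx N" for j
    using P that assms(1) by (auto simp: b_def pos_trig_iff)
  have sublevel: "q \<in> K" if q: "q \<in> pos_trig n N" and le: "dual n N c P q \<le> dual n N c P P" for q
  proof -
    define t where "t j = \<delta> * grid_val n N q j - b j * ln (grid_val n N q j)" for j
    have qpos: "0 < grid_val n N q j" if "j \<in> idx N" for j
      using q that by (simp add: pos_trig_iff)
    have "(\<Sum>j\<in>idx N. t j) \<le> dual n N c P P"
      using \<delta>[OF q] le
      by (simp add: dual_eq[of n N c P q] t_def b_def sum_subtractf sum_distrib_left)
    have "t j \<le> M" if j: "j \<in> idx N" for j
    proof -
      have lower: "0 \<le> t i + \<bar>m i\<bar>" if "i \<in> idx N" for i
        using linear_minus_ln_lower_bound[OF \<open>0 < \<delta>\<close> b[OF that] qpos[OF that]]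
          mult_pos_pos[OF \<open>0 < \<delta>\<close> qpos[OF that]]
        unfolding t_def m_def[symmetric] by linarith
      have "t j + \<bar>m j\<bar> \<le> (\<Sum>i\<in>idx N. t i + \<bar>m i\<bar>)"
        using j lower by (intro member_le_sum) auto
      then show ?thesis
        using \<open>(\<Sum>j\<in>idx N. t j) \<le> dual n N c P P\<close> by (simp add: M_def sum.distrib)
    qed
    then have "l j \<le> grid_val n N q j" "grid_val n N q j \<le> u j" if "j \<in> idx N" for j
      using linear_minus_ln_sublevel[OF \<open>0 < \<delta>\<close> b[OF that] qpos[OF that], of M] that
      unfolding l_def u_def m_def t_def by blast+
    then show ?thesis
      using q by (simp add: K_def pos_trig_iff)
  qed
  have "compact K"
    unfolding K_def by (rule compact_grid_box[OF assms(1)])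
  moreover have K_pos: "K \<subseteq> pos_trig n N"
  proof
    fix q assume "q \<in> K"
    then show "q \<in> pos_trig n N"
      unfolding K_def pos_trig_iff l_def by (auto intro: less_le_trans[OF exp_gt_zero])
  qed
  moreover have "P \<in> K"
    using sublevel P by blast
  moreover have "continuous_on K (dual n N c P)"
  proof -
    have "continuous_on K (\<lambda>q. dual n N c P q)"
      unfolding dual_eq
      by (intro continuous_intros continuous_on_pairing continuous_on_grid_val)
        (use K_pos in \<open>force simp: pos_trig_iff\<close>)
    then show ?thesis
      by simp
  qed
  ultimately obtain Q where Q: "Q \<in> K" "\<And>q. q \<in> K \<Longrightarrow> dual n N c P Q \<le> dual n N c P q"
    using continuous_attains_inf[of K "dual n N c P"] by blast
  show thesis
  proof
    show "Q \<in> pos_trig n N"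
      using Q(1) K_pos by blast
    fix q
    assume q: "q \<in> pos_trig n N"
    show "dual n N c P Q \<le> dual n N c P q"
    proof (cases "dual n N c P q \<le> dual n N c P P")
      case True
      then show ?thesis
        using sublevel[OF q] Q(2) by blast
    next
      case False
      then show ?thesis
        using Q(2)[OF \<open>P \<in> K\<close>] by linarith
    qed
  qed
qed

section \<open>Stationarity and the moment conditions\<close>

text \<open>The derivative at \<open>t = 0\<close> of the dual functional along \<open>Q + t h\<close>. Finitely many strict
  inequalities define the cone, so \<open>Q + t h\<close> stays in it for small \<open>t\<close> of either sign.\<close>

lemma dual_stationary:
  assumes Q: "Q \<in> pos_trig n N" and min: "\<And>q. q \<in> pos_trig n N \<Longrightarrow> dual n N c P Q \<le> dual n N c P q"
    and h: "h \<in> sym_trig n"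
  shows "Re (pairing n (herm_ext c) h) =
    (\<Sum>j\<in>idx N. grid_val n N P j / (2 * real N) * (grid_val n N h j / grid_val n N Q j))"
proof -
  define g where "g t = dual n N c P (line_comb Q t h)" for t
  have Qpos: "0 < grid_val n N Q j" if "j \<in> idx N" for j
    using Q that by (simp add: pos_trig_iff)
  have g: "g = (\<lambda>t. Re (pairing n (herm_ext c) Q) + t * Re (pairing n (herm_ext c) h)
     - (\<Sum>j\<in>idx N. grid_val n N P j / (2 * real N) * ln (grid_val n N Q j + t * grid_val n N h j)))"
    by (simp add: g_def fun_eq_iff dual_eq grid_val_line_comb pairing_line_comb)
  have deriv: "(g has_real_derivative Re (pairing n (herm_ext c) h) -
     (\<Sum>j\<in>idx N. grid_val n N P j / (2 * real N) * (grid_val n N h j / grid_val n N Q j))) (at 0)"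
    unfolding g
    by (rule derivative_eq_intros refl | use Qpos in \<open>force\<close>)+
      (simp add: field_simps)
  have "\<forall>\<^sub>F t in nhds 0. \<forall>j\<in>idx N. 0 < grid_val n N Q j + t * grid_val n N h j"
  proof (intro eventually_ball_finite ballI)
    fix j assume j: "j \<in> idx N"
    have "((\<lambda>t. grid_val n N Q j + t * grid_val n N h j) \<longlongrightarrow> grid_val n N Q j + 0 * grid_val n N h j) (nhds 0)"
      by (intro tendsto_intros filterlim_ident)
    then show "\<forall>\<^sub>F t in nhds 0. 0 < grid_val n N Q j + t * grid_val n N h j"
      using Qpos[OF j] by (intro order_tendstoD(1)) auto
  qed simp
  then obtain d where "0 < d" and d: "\<And>t. dist t 0 < d \<Longrightarrow> line_comb Q t h \<in> pos_trig n N"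
    using Q h unfolding eventually_nhds_metric
    by (auto simp: pos_trig_iff sym_trig_line_comb grid_val_line_comb)
  have "\<forall>t. \<bar>0 - t\<bar> < d \<longrightarrow> g 0 \<le> g t"
    using min d by (auto simp: g_def dist_real_def)
  then show ?thesis
    using DERIV_local_min[OF deriv \<open>0 < d\<close>] by simp
qed

lemma zeta_in_grid: "j \<in> idx N \<Longrightarrow> zeta N j \<in> grid N"
  by (simp add: grid_def)

lemma trig_quot_zeta:
  "j \<in> idx N \<Longrightarrow> trig_quot n N P Q (zeta N j) = grid_val n N P j / grid_val n N Q j"
  by (simp add: trig_quot_def grid_val_def zeta_in_grid)

text \<open>The moment conditions for \<open>0 \<le> k \<le> n\<close> hold for negative indices as well by conjugation, since
  \<open>\<Phi>\<close> is real. The pairing is then a linear functional of the grid values, with weights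
  \<open>\<Phi>(\<zeta>\<^sub>j)\<close>.\<close>

lemma pairing_eq_grid_sum:
  assumes c: "c 0 \<in> \<real>" and \<Phi>: "\<Phi> \<in> feasible n N c" and q: "q \<in> sym_trig n"
  shows "Re (pairing n (herm_ext c) q)
    = 1 / (2 * real N) * (\<Sum>j\<in>idx N. \<Phi> (zeta N j) * grid_val n N q j)"
proof -
  have moment: "herm_ext c k = 1 / (2 * of_nat N) * (\<Sum>j\<in>idx N. zeta N j powi k * of_real (\<Phi> (zeta N j)))"
    if k: "k \<in> {- int n..int n}" for k
  proof -
    have nonneg: "c i = 1 / (2 * of_nat N) * (\<Sum>j\<in>idx N. zeta N j ^ i * of_real (\<Phi> (zeta N j)))"
      if "i \<le> n" for i
      using \<Phi> that by (auto simp: feasible_def)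
    show ?thesis
    proof (cases "0 \<le> k")
      case True
      then show ?thesis
        using k nonneg[of "nat k"] by (simp add: herm_ext_def power_int_def)
    next
      case False
      then show ?thesis
        using k nonneg[of "nat (- k)"] by (simp add: herm_ext_def power_int_def cnj_zeta)
    qed
  qed
  have cnj_q: "trig_poly n q (zeta N j) = (\<Sum>k = - int n..int n. zeta N j powi k * cnj (q k))" for j
    unfolding trig_poly_def
    by (rule sum.reindex_bij_witness[of _ uminus uminus]) (use q in \<open>auto simp: sym_trig_def\<close>)
  have "pairing n (herm_ext c) q = (\<Sum>k = - int n..int n.
      1 / (2 * of_nat N) * (\<Sum>j\<in>idx N. zeta N j powi k * of_real (\<Phi> (zeta N j))) * cnj (q k))"
    unfolding pairing_def by (intro sum.cong refl) (simp add: moment)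
  also have "\<dots> = 1 / (2 * of_nat N) *
      (\<Sum>k = - int n..int n. \<Sum>j\<in>idx N. of_real (\<Phi> (zeta N j)) * (zeta N j powi k * cnj (q k)))"
    by (simp add: sum_distrib_left sum_distrib_right mult_ac)
  also have "\<dots> = 1 / (2 * of_nat N) *
      (\<Sum>j\<in>idx N. of_real (\<Phi> (zeta N j)) * trig_poly n q (zeta N j))"
    by (subst sum.swap) (simp add: cnj_q sum_distrib_left)
  also have "\<dots> = of_real (1 / (2 * real N) * (\<Sum>j\<in>idx N. \<Phi> (zeta N j) * grid_val n N q j))"
    using q by (simp add: trig_poly_eq_grid_val)
  finally show ?thesis
    by (simp only: Re_complex_of_real)
qed

text \<open>Let \<open>a\<close> be the error in the \<open>k\<close>-th moment. Stationarity in the direction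
  \<open>a \<zeta>\<^sup>-\<^sup>k + cnj a \<zeta>\<^sup>k\<close> says that the real part of \<open>a \<cdot> cnj a\<close> is zero.\<close>

lemma stationary_quot_feasible:
  assumes c: "c 0 \<in> \<real>" and P: "P \<in> pos_trig n N" and Q: "Q \<in> pos_trig n N"
    and min: "\<And>q. q \<in> pos_trig n N \<Longrightarrow> dual n N c P Q \<le> dual n N c P q"
  shows "trig_quot n N P Q \<in> feasible n N c"
proof -
  define \<Phi> where "\<Phi> = trig_quot n N P Q"
  have "\<Phi> \<in> grid N \<rightarrow>\<^sub>E {0<..}"
    using P Q by (auto simp: \<Phi>_def trig_quot_def pos_trig_def grid_def)
  moreover have "1 / (2 * of_nat N) * (\<Sum>j\<in>idx N. zeta N j ^ k * of_real (\<Phi> (zeta N j))) = c k"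
    (is "?\<mu> = c k") if k: "k \<le> n" for k
  proof -
    define a where "a = c k - ?\<mu>"
    \<comment> \<open>A sum of two conditionals, so that for \<open>k = 0\<close> both contributions fall on the same coefficient
      and the computation is uniform in \<open>k\<close>.\<close>
    define h where "h i = (if i = int k then a else 0) + (if i = - int k then cnj a else 0)" for i
    have h: "h \<in> sym_trig n"
      using k by (auto simp: h_def sym_trig_def)
    have k': "int k \<in> {- int n..int n}" "- int k \<in> {- int n..int n}"
      using k by auto
    have "herm_ext c (- int k) = cnj (c k)"
      using c by (cases "k = 0") (auto simp: herm_ext_def Reals_cnj_iff)
    then have "pairing n (herm_ext c) h = c k * cnj a + cnj (c k) * a"
      using k' by (simp add: pairing_def h_def if_distrib[of cnj] if_distrib[of "\<lambda>x. _ * x"]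
          distrib_left sum.distrib herm_ext_def cong: if_cong)
    then have pair: "Re (pairing n (herm_ext c) h) = 2 * Re (c k * cnj a)"
      by simp
    have "trig_poly n h (zeta N j) = a * zeta N j powi (- int k) + cnj a * zeta N j ^ k" for j
      using k' by (simp add: trig_poly_def h_def if_distrib[of "\<lambda>x. x * _"]
          distrib_right sum.distrib cong: if_cong)
    moreover have "zeta N j powi (- int k) = cnj (zeta N j ^ k)" for j
      by (simp add: cnj_zeta power_int_minus power_inverse)
    ultimately have val: "grid_val n N h j = 2 * Re (zeta N j ^ k * cnj a)" for j
      by (simp add: grid_val_def flip: complex_cnj_power)
    have "2 * Re (c k * cnj a)
        = (\<Sum>j\<in>idx N. grid_val n N P j / (2 * real N) * (grid_val n N h j / grid_val n N Q j))"
      using dual_stationary[OF Q min h] pair by simp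
    also have "\<dots> = (\<Sum>j\<in>idx N. 1 / (2 * real N) * (\<Phi> (zeta N j) * (2 * Re (zeta N j ^ k * cnj a))))"
      by (intro sum.cong refl) (simp add: \<Phi>_def trig_quot_zeta val)
    also have "\<dots> = 2 * Re (?\<mu> * cnj a)"
    proof -
      have "?\<mu> * cnj a = (\<Sum>j\<in>idx N. (\<Phi> (zeta N j) / (2 * real N)) *\<^sub>R (zeta N j ^ k * cnj a))"
        unfolding sum_distrib_left sum_distrib_right by (simp add: scaleR_conv_of_real mult_ac)
      then have "Re (?\<mu> * cnj a) = (\<Sum>j\<in>idx N. \<Phi> (zeta N j) / (2 * real N) * Re (zeta N j ^ k * cnj a))"
        by (simp only: Re_sum scaleR_complex.sel)
      then show ?thesis
        by (simp only: sum_distrib_left) (intro sum.cong refl, simp add: field_simps)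
    qed
    finally have "Re (c k * cnj a) = Re (?\<mu> * cnj a)"
      by linarith
    moreover have "a * cnj a = c k * cnj a - ?\<mu> * cnj a"
      by (simp only: a_def left_diff_distrib)
    ultimately have "Re (a * cnj a) = 0"
      by (simp only: minus_complex.sel)
    then have "a = 0"
      by (simp add: complex_mult_cnj complex_eq_iff)
    then show ?thesis
      by (simp add: a_def)
  qed
  ultimately show ?thesis
    by (simp add: feasible_def \<Phi>_def)
qed

section \<open>Optimality\<close>

text \<open>Up to the factor \<open>1/(2N)\<close>, the loss in the primal value is the sum of the gaps
  \<open>p\<^sub>j (x\<^sub>j - 1 - ln x\<^sub>j) \<ge> 0\<close> with \<open>x\<^sub>j = \<Phi>(\<zeta>\<^sub>j) q\<^sub>j / p\<^sub>j\<close>: the linear parts cancel because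
  \<open>\<Phi>\<close> and \<open>P/Q\<close> have the same moments and therefore the same pairing with \<open>Q\<close>.\<close>

lemma primal_le_trig_quot:
  assumes N: "0 < N" and c: "c 0 \<in> \<real>" and P: "P \<in> pos_trig n N" and Q: "Q \<in> pos_trig n N"
    and feas: "trig_quot n N P Q \<in> feasible n N c" and \<Phi>: "\<Phi> \<in> feasible n N c"
  shows "primal n N P \<Phi> \<le> primal n N P (trig_quot n N P Q)"
    and "primal n N P \<Phi> = primal n N P (trig_quot n N P Q) \<Longrightarrow> \<Phi> = trig_quot n N P Q"
proof -
  define p where "p j = grid_val n N P j" for j
  define q where "q j = grid_val n N Q j" for j
  define f where "f j = \<Phi> (zeta N j)" for j
  define x where "x j = f j * q j / p j" for j
  have pos: "0 < p j" "0 < q j" "0 < f j" if "j \<in> idx N" for j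
    using P Q \<Phi> that zeta_in_grid[OF that]
    by (auto simp: p_def q_def f_def pos_trig_iff feasible_def PiE_iff)
  have xpos: "0 < x j" if "j \<in> idx N" for j
    using pos[OF that] by (simp add: x_def)
  have quot: "trig_quot n N P Q (zeta N j) = p j / q j" if "j \<in> idx N" for j
    using that by (simp add: trig_quot_zeta p_def q_def)
  have "(\<Sum>j\<in>idx N. f j * q j) = (\<Sum>j\<in>idx N. p j / q j * q j)"
    using pairing_eq_grid_sum[of c \<Phi> n N Q] pairing_eq_grid_sum[of c "trig_quot n N P Q" n N Q]
      c \<Phi> Q feas N by (simp add: pos_trig_iff f_def q_def[symmetric] quot cong: sum.cong)
  also have "\<dots> = (\<Sum>j\<in>idx N. p j)"
    by (intro sum.cong refl) (use pos in force)
  finally have mass: "(\<Sum>j\<in>idx N. f j * q j) = (\<Sum>j\<in>idx N. p j)" .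
  define gap where "gap j = p j * (x j - 1 - ln (x j))" for j
  have gap: "p j * ln (p j / q j) - p j * ln (f j) = gap j - (f j * q j - p j)"
    if "j \<in> idx N" for j
  proof -
    have "ln (x j) = ln (f j) - ln (p j / q j)"
      using pos[OF that] by (simp add: x_def ln_mult ln_div)
    moreover have "p j * x j = f j * q j"
      using pos[OF that] by (simp add: x_def)
    ultimately show ?thesis
      by (simp add: gap_def right_diff_distrib distrib_left)
  qed
  have gap_nonneg: "0 \<le> gap j" if "j \<in> idx N" for j
    using pos[OF that] ln_le_minus_one[OF xpos[OF that]] by (simp add: gap_def)
  have "primal n N P (trig_quot n N P Q) - primal n N P \<Phi>
      = 1 / (2 * real N) * (\<Sum>j\<in>idx N. p j * ln (p j / q j) - p j * ln (f j))"
    by (simp add: primal_def grid_val_def[symmetric] p_def[symmetric] f_def quot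
        sum_subtractf right_diff_distrib cong: sum.cong)
  also have "\<dots> = 1 / (2 * real N) * (\<Sum>j\<in>idx N. gap j)"
    using mass by (simp add: gap sum_subtractf cong: sum.cong)
  finally have diff: "primal n N P (trig_quot n N P Q) - primal n N P \<Phi>
      = 1 / (2 * real N) * (\<Sum>j\<in>idx N. gap j)" .
  have "0 \<le> 1 / (2 * real N) * (\<Sum>j\<in>idx N. gap j)"
    by (intro mult_nonneg_nonneg sum_nonneg gap_nonneg) auto
  then show "primal n N P \<Phi> \<le> primal n N P (trig_quot n N P Q)"
    using diff by linarith
  assume "primal n N P \<Phi> = primal n N P (trig_quot n N P Q)"
  then have "(\<Sum>j\<in>idx N. gap j) = 0"
    using diff N by simp
  then have "gap j = 0" if "j \<in> idx N" for j
    using that by (simp add: sum_nonneg_eq_0_iff gap_nonneg)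
  then have "x j = 1" if "j \<in> idx N" for j
    using pos[OF that] that ln_eq_minus_one[OF xpos[OF that]] by (fastforce simp: gap_def)
  then have "f j = p j / q j" if "j \<in> idx N" for j
    using pos[OF that] that by (force simp: x_def field_simps)
  then have "\<Phi> z = trig_quot n N P Q z" if "z \<in> grid N" for z
    using that quot by (auto simp: grid_def f_def)
  then show "\<Phi> = trig_quot n N P Q"
    using \<Phi> feas by (intro PiE_ext[of _ "grid N" "\<lambda>_. {0<..}"]) (auto simp: feasible_def)
qed

theorem theorem2:
  fixes n N :: nat and c :: "nat \<Rightarrow> complex" and P :: "int \<Rightarrow> complex"
  assumes "0 < n" and "n < N"
    and "c \<in> dual_cone n N"
    and "P \<in> pos_trig n N"
  shows "(\<exists>!Q. is_arg_min (dual n N c P) (\<lambda>Q. Q \<in> pos_trig n N) Q) \<and>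
    (\<exists>!\<Phi>. is_arg_max (primal n N P) (\<lambda>\<Phi>. \<Phi> \<in> feasible n N c) \<Phi>) \<and>
    (\<forall>Q. is_arg_min (dual n N c P) (\<lambda>Q. Q \<in> pos_trig n N) Q \<longrightarrow>
      is_arg_max (primal n N P) (\<lambda>\<Phi>. \<Phi> \<in> feasible n N c) (trig_quot n N P Q))"
proof -
  let ?min = "is_arg_min (dual n N c P) (\<lambda>Q. Q \<in> pos_trig n N)"
  let ?max = "is_arg_max (primal n N P) (\<lambda>\<Phi>. \<Phi> \<in> feasible n N c)"
  have N: "0 < N" and c: "c 0 \<in> \<real>"
    using assms(2,3) by (auto simp: dual_cone_def)
  obtain Q0 where Q0: "?min Q0"
    using dual_minimiser_exists[OF assms(2-4)] unfolding is_arg_min_linorder by metis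
  have feas: "trig_quot n N P Q \<in> feasible n N c" if "?min Q" for Q
    using that stationary_quot_feasible[of c P n N Q] c assms(4)
    by (auto simp: is_arg_min_linorder)
  have max: "?max (trig_quot n N P Q)" if "?min Q" for Q
    using that feas[OF that] primal_le_trig_quot(1)[of N c P n Q] N c assms(4)
    by (auto simp: is_arg_max_linorder is_arg_min_linorder)
  have unique: "\<Phi> = trig_quot n N P Q" if "?min Q" and "?max \<Phi>" for Q \<Phi>
  proof (rule primal_le_trig_quot(2))
    show "primal n N P \<Phi> = primal n N P (trig_quot n N P Q)"
      using that(2) max[OF that(1)] by (auto simp: is_arg_max_linorder intro: antisym)
  qed (use that feas N c assms(4) in \<open>auto simp: is_arg_max_linorder is_arg_min_linorder\<close>)
  have min_unique: "Q = Q0" if Q: "?min Q" for Q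
  proof (rule sym_trig_eqI[OF assms(2)])
    show "Q \<in> sym_trig n" "Q0 \<in> sym_trig n"
      using Q Q0 by (auto simp: is_arg_min_linorder pos_trig_iff)
    fix j
    assume j: "j \<in> idx N"
    have "grid_val n N P j / grid_val n N Q j = grid_val n N P j / grid_val n N Q0 j"
      using unique[OF Q0 max[OF Q]] trig_quot_zeta[OF j] by metis
    moreover have "0 < grid_val n N P j" "0 < grid_val n N Q j" "0 < grid_val n N Q0 j"
      using j assms(4) Q Q0 by (auto simp: is_arg_min_linorder pos_trig_iff)
    ultimately show "grid_val n N Q j = grid_val n N Q0 j"
      by (simp add: field_simps)
  qed
  show ?thesis
  proof (intro conjI allI impI)
    show "\<exists>!Q. ?min Q"
      using Q0 min_unique by (rule ex1I)
    show "\<exists>!\<Phi>. ?max \<Phi>"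
      using max[OF Q0] unique[OF Q0] by (rule ex1I)
  qed (rule max)
qed

end
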